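(* The set \[ \bigg\{ \sum_{n=1}^{\infty} \frac{1}{\prod_{i=1}^{f(n)}(n+i)} \,:\, (f(n))_{n=1}^{\infty}\in\mathbb{N}^{\mathbb{N}} \text{ is nondecreasing (i.e. } f(1)\le f(2)\le f(3)\le\cdots),\ \lim_{n\to\infty} f(n) = \infty \bigg\} \] has zero Lebesgue measure and, consequently, empty interior.
   Context: $\mathbb{N}$ denotes the set of positive integers, and $\mathbb{N}^{\mathbb{N}}$ the set of all sequences of positive integers. *)

theory Defs
  imports "HOL-Analysis.Analysis"
begin

text \<open>
  A sequence \<open>f(1), f(2), \<dots>\<close> of positive integers is a function \<open>nat \<Rightarrow> nat\<close> of which only the
  values at arguments \<open>n \<ge> 1\<close> are constrained and used; the value \<open>f 0\<close> is irrelevant.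
\<close>

definition nondecreasing_unbounded_seqs :: "(nat \<Rightarrow> nat) set" where
  "nondecreasing_unbounded_seqs =
     {f. (\<forall>n\<ge>1. 1 \<le> f n) \<and> mono_on {1..} f \<and> filterlim f at_top sequentially}"

definition rising_term :: "(nat \<Rightarrow> nat) \<Rightarrow> nat \<Rightarrow> real" where
  "rising_term f n = 1 / (\<Prod>i=1..f n. real (n + i))"

text \<open>The series starts at \<open>n = 1\<close>, hence the shift by \<open>Suc\<close>.\<close>

definition rising_sum :: "(nat \<Rightarrow> nat) \<Rightarrow> real" where
  "rising_sum f = (\<Sum>n. rising_term f (Suc n))"

definition rising_sum_set :: "real set" where
  "rising_sum_set = {rising_sum f | f. f \<in> nondecreasing_unbounded_seqs}"

text \<open>
  The series converges for every admissible \<open>f\<close>, so \<^const>\<open>suminf\<close> never takes a default value in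
  \<^const>\<open>rising_sum_set\<close>.
\<close>

lemma summable_rising_term:
  assumes "f \<in> nondecreasing_unbounded_seqs"
  shows "summable (\<lambda>n. rising_term f (Suc n))"
proof -
  have lim: "filterlim f at_top sequentially"
    using assms by (simp add: nondecreasing_unbounded_seqs_def)
  have ev: "eventually (\<lambda>n. f n \<ge> 2) sequentially"
    using lim by (simp add: filterlim_at_top)
  have "eventually (\<lambda>n. norm (rising_term f n) \<le> inverse (real n ^ 2)) sequentially"
    using ev eventually_gt_at_top[of 0]
  proof eventually_elim
    case (elim n)
    have "real n ^ 2 \<le> (\<Prod>i\<in>{1..2}. real (n + i))"
      by (simp add: numeral_2_eq_2 power2_eq_square algebra_simps)
    also have "\<dots> \<le> (\<Prod>i\<in>{1..f n}. real (n + i))"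
      using elim by (intro prod_mono2) auto
    finally have le: "real n ^ 2 \<le> (\<Prod>i=1..f n. real (n + i))" .
    have "0 < real n ^ 2" using elim by simp
    from le_imp_inverse_le[OF le this] this le show ?case
      by (simp add: rising_term_def inverse_eq_divide abs_of_nonneg prod_nonneg)
  qed
  then have "summable (rising_term f)"
    by (rule summable_comparison_test_ev) (rule inverse_power_summable, simp)
  then show ?thesis by (simp only: summable_Suc_iff)
qed

end

theory Submission
  imports Defs
begin

text \<open>
  Let \<open>T k m\<close> be the set of all tails \<open>\<Sum>n\<ge>m. 1 / ((n+1)\<cdots>(n+f n))\<close> with \<open>f\<close> nondecreasing, unbounded
  and at least \<open>k\<close> on \<open>{m..}\<close>. Cutting at the first \<open>m' \<ge> m\<close> with \<open>f m' > k\<close> exhibits \<open>T k m\<close> as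
  a union over \<open>m' \<ge> m\<close> of translates of \<open>T (k+1) m'\<close>. The sum
  \<open>\<Sum>n\<ge>m. 1 / ((n+1)\<cdots>(n+k))\<close> telescopes to \<open>1 / ((k-1) (m+1)\<cdots>(m+k-1))\<close>, which bounds the
  diameter of \<open>T k m\<close>. Feeding this bound into the decomposition \<open>i\<close> times, telescoping again at
  every step, improves it by the factor \<open>1 / (k (k+1)\<cdots>(k+i-1))\<close>. Hence \<open>T k m\<close> is null for
  \<open>k \<ge> 2\<close>, and the set in question is covered by countably many translates (by rationals) of the
  sets \<open>T 2 m\<close>.
\<close>

definition rising_prod :: "nat \<Rightarrow> nat \<Rightarrow> real" where
  "rising_prod k n = (\<Prod>i=1..k. real (n + i))"

lemma rising_term_eq: "rising_term f n = 1 / rising_prod (f n) n"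
  by (simp add: rising_term_def rising_prod_def)

lemma rising_prod_pos: "0 < rising_prod k n"
  unfolding rising_prod_def by (intro prod_pos) auto

lemma rising_prod_Suc: "rising_prod (Suc k) n = rising_prod k n * (real n + real k + 1)"
  by (simp add: rising_prod_def algebra_simps)

text \<open>Splits off the first factor instead of the last. Equating the two factorisations of one
  product is what makes the series of reciprocals telescope.\<close>

lemma rising_prod_Suc': "rising_prod (Suc k) n = (real n + 1) * rising_prod k (Suc n)"
  by (induction k) (simp_all add: rising_prod_Suc, simp add: rising_prod_def)

lemma rising_prod_mono: "k \<le> l \<Longrightarrow> rising_prod k n \<le> rising_prod l n"
  unfolding rising_prod_def by (intro prod_mono2) auto

lemma inverse_rising_prod_tendsto_0:
  assumes "1 \<le> k"
  shows "(\<lambda>d. 1 / rising_prod k (m + d)) \<longlonglongrightarrow> 0"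
proof (rule tendsto_sandwich[OF _ _ tendsto_const LIMSEQ_inverse_real_of_nat])
  show "\<forall>\<^sub>F d in sequentially. 0 \<le> 1 / rising_prod k (m + d)"
    by (simp add: rising_prod_pos less_imp_le)
  have "1 / rising_prod k (m + d) \<le> inverse (real (Suc d))" for d
  proof -
    have "real (Suc d) \<le> rising_prod 1 (m + d)" by (simp add: rising_prod_def)
    also have "\<dots> \<le> rising_prod k (m + d)" using assms by (rule rising_prod_mono)
    finally show ?thesis by (simp add: inverse_eq_divide frac_le)
  qed
  then show "\<forall>\<^sub>F d in sequentially. 1 / rising_prod k (m + d) \<le> inverse (real (Suc d))"
    by simp
qed

text \<open>Each term is \<open>1 / k\<close> times the drop of \<open>1 / rising_prod k\<close>
  between consecutive arguments, and these reciprocals vanish at infinity. Indexing by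
  \<open>Suc k\<close> avoids subtraction on \<open>nat\<close>.\<close>

lemma inverse_rising_prod_sums:
  assumes "1 \<le> k"
  shows "(\<lambda>d. 1 / rising_prod (Suc k) (m + d)) sums (1 / (real k * rising_prod k m))"
proof -
  have tel: "1 / rising_prod (Suc k) n
      = (1 / rising_prod k n - 1 / rising_prod k (Suc n)) / real k" for n
  proof -
    let ?p = "rising_prod k n" and ?q = "rising_prod k (Suc n)"
    have pq: "?p * (real n + real k + 1) = (real n + 1) * ?q"
      using rising_prod_Suc rising_prod_Suc' by metis
    have pos: "0 < ?p" "0 < ?q" "0 < real k" "0 < real n + 1"
      using rising_prod_pos assms by auto
    have "?p * real k = (real n + 1) * (?q - ?p)"
      using pq by (simp add: algebra_simps)
    then have "(?q - ?p) / (?p * ?q) = real k / ((real n + 1) * ?q)"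
      using pos by (simp add: frac_eq_eq mult_ac)
    moreover have "1 / ?p - 1 / ?q = (?q - ?p) / (?p * ?q)"
      using pos by (simp add: diff_frac_eq)
    ultimately show ?thesis
      using pos by (simp add: rising_prod_Suc')
  qed
  from telescope_sums'[OF inverse_rising_prod_tendsto_0[OF assms, of m]]
  have "(\<lambda>d. 1 / rising_prod k (m + d) - 1 / rising_prod k (m + Suc d))
      sums (1 / rising_prod k m)"
    by simp
  from sums_divide[OF this, of "real k"] show ?thesis
    by (simp add: tel mult.commute)
qed

definition tail_seqs :: "nat \<Rightarrow> nat \<Rightarrow> (nat \<Rightarrow> nat) set" where
  "tail_seqs k m = {f. (\<forall>n\<ge>m. k \<le> f n) \<and> mono_on {m..} f \<and> filterlim f at_top sequentially}"

definition tail_sums :: "nat \<Rightarrow> nat \<Rightarrow> real set" where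
  "tail_sums k m = (\<lambda>f. \<Sum>d. rising_term f (m + d)) ` tail_seqs k m"

lemma rising_term_nonneg: "0 \<le> rising_term f n"
  by (simp add: rising_term_eq rising_prod_pos less_imp_le)

lemma rising_term_le: "k \<le> f n \<Longrightarrow> rising_term f n \<le> 1 / rising_prod k n"
  by (simp add: rising_term_eq frac_le rising_prod_mono rising_prod_pos)

lemma summable_tail:
  assumes "1 \<le> k" "f \<in> tail_seqs (Suc k) m"
  shows "summable (\<lambda>d. rising_term f (m + d))"
proof (rule summable_comparison_test')
  show "summable (\<lambda>d. 1 / rising_prod (Suc k) (m + d))"
    using inverse_rising_prod_sums[OF assms(1)] by (rule sums_summable)
  show "norm (rising_term f (m + d)) \<le> 1 / rising_prod (Suc k) (m + d)" for d
    using assms(2) rising_term_le[of "Suc k" f "m + d"]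
    by (simp add: rising_term_nonneg tail_seqs_def)
qed

lemma tail_sums_subset:
  assumes "1 \<le> k"
  shows "tail_sums (Suc k) m \<subseteq> {0..1 / (real k * rising_prod k m)}"
proof
  fix x assume "x \<in> tail_sums (Suc k) m"
  then obtain f where f: "f \<in> tail_seqs (Suc k) m" and x: "x = (\<Sum>d. rising_term f (m + d))"
    by (auto simp: tail_sums_def)
  note sf = summable_tail[OF assms f]
  note s = inverse_rising_prod_sums[OF assms, of m]
  have "x \<le> (\<Sum>d. 1 / rising_prod (Suc k) (m + d))"
    unfolding x using f
    by (intro suminf_le sf sums_summable[OF s] rising_term_le) (simp add: tail_seqs_def)
  then show "x \<in> {0..1 / (real k * rising_prod k m)}"
    using suminf_nonneg[OF sf rising_term_nonneg] sums_unique[OF s] by (simp add: x)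
qed

lemma tail_sums_decompose:
  assumes "1 \<le> k"
  shows "tail_sums (Suc k) m \<subseteq>
    (\<Union>d. (+) (\<Sum>i<d. 1 / rising_prod (Suc k) (m + i)) ` tail_sums (Suc (Suc k)) (m + d))"
proof
  fix x assume "x \<in> tail_sums (Suc k) m"
  then obtain f where f: "f \<in> tail_seqs (Suc k) m" and x: "x = (\<Sum>d. rising_term f (m + d))"
    by (auto simp: tail_sums_def)
  have ge: "Suc k \<le> f n" if "m \<le> n" for n using f that by (simp add: tail_seqs_def)
  have mono: "mono_on {m..} f" and lim: "filterlim f at_top sequentially"
    using f by (auto simp: tail_seqs_def)
  have "eventually (\<lambda>n. Suc (Suc k) \<le> f n) sequentially"
    using lim by (simp add: filterlim_at_top)
  then obtain N where "\<forall>n\<ge>N. Suc (Suc k) \<le> f n"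
    by (auto simp: eventually_sequentially)
  then have ex: "Suc (Suc k) \<le> f (m + N)" by simp
  \<comment> \<open>By minimality of \<open>d\<close> and the lower bound \<open>Suc k\<close>,
    \<open>f\<close> is constantly \<open>Suc k\<close> on the \<open>d\<close> places before the
    cut.\<close>
  define d where "d = (LEAST d. Suc (Suc k) \<le> f (m + d))"
  have d: "Suc (Suc k) \<le> f (m + d)" unfolding d_def using ex by (rule LeastI)
  have eq: "f (m + i) = Suc k" if "i < d" for i
    using not_less_Least[OF that[unfolded d_def]] ge[of "m + i"] by simp
  have "Suc (Suc k) \<le> f n" if "m + d \<le> n" for n
    using d mono_onD[OF mono, of "m + d" n] that by simp
  then have f': "f \<in> tail_seqs (Suc (Suc k)) (m + d)"
    using mono lim by (auto simp: tail_seqs_def intro: mono_on_subset)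
  have "x = (\<Sum>n. rising_term f (m + (n + d))) + (\<Sum>i<d. rising_term f (m + i))"
    unfolding x by (rule suminf_split_initial_segment[OF summable_tail[OF assms f]])
  \<comment> \<open>The head now depends on \<open>d\<close> alone and no longer on
    \<open>f\<close>, so countably many translates suffice.\<close>
  also have "(\<Sum>i<d. rising_term f (m + i)) = (\<Sum>i<d. 1 / rising_prod (Suc k) (m + i))"
    by (intro sum.cong) (simp_all add: rising_term_eq eq)
  finally have "x = (\<Sum>i<d. 1 / rising_prod (Suc k) (m + i)) + (\<Sum>n. rising_term f (m + d + n))"
    by (simp add: add_ac)
  then show "x \<in> (\<Union>d. (+) (\<Sum>i<d. 1 / rising_prod (Suc k) (m + i))
      ` tail_sums (Suc (Suc k)) (m + d))"
    using f' by (auto simp: tail_sums_def)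
qed

text \<open>Countable choice of covers, needed once over the cut positions and once over the
  improving bounds.\<close>

lemma measurable_cover_choice:
  assumes "\<forall>d. \<exists>B\<in>sets M. A d \<subseteq> B \<and> emeasure M B \<le> e d"
  obtains B where "\<And>d. B d \<in> sets M" "\<And>d. A d \<subseteq> B d" "\<And>d. emeasure M (B d) \<le> e d"
  using assms by metis

text \<open>The arbitrary translation \<open>c\<close> makes the induction hypothesis apply to the translates produced
  by the decomposition.\<close>

lemma tail_sums_cover:
  assumes "1 \<le> k"
  shows "\<exists>B\<in>sets lborel. (+) c ` tail_sums (Suc k) m \<subseteq> B \<and>
    emeasure lborel B \<le> ennreal (1 / (pochhammer (real k) (Suc i) * rising_prod k m))"
  using assms
proof (induction i arbitrary: k m c)
  case 0
  let ?l = "1 / (real k * rising_prod k m)"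
  have "0 \<le> ?l" by (simp add: rising_prod_pos less_imp_le)
  then have "emeasure lborel {c..c + ?l} = ennreal ?l" by simp
  moreover have "(+) c ` tail_sums (Suc k) m \<subseteq> {c..c + ?l}"
    using tail_sums_subset[OF 0, of m] by auto
  ultimately show ?case by (intro bexI[of _ "{c..c + ?l}"]) simp_all
next
  case (Suc i)
  define s where "s d = (\<Sum>i<d. 1 / rising_prod (Suc k) (m + i))" for d
  define p where "p = pochhammer (real (Suc k)) (Suc i)"
  have p: "0 < p" unfolding p_def by (rule pochhammer_pos) simp
  have "\<forall>d. \<exists>B\<in>sets lborel. (+) (c + s d) ` tail_sums (Suc (Suc k)) (m + d) \<subseteq> B \<and>
    emeasure lborel B \<le> ennreal (1 / (p * rising_prod (Suc k) (m + d)))"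
    unfolding p_def by (intro allI Suc.IH) simp
  then obtain B where B: "\<And>d. B d \<in> sets lborel"
      "\<And>d. (+) (c + s d) ` tail_sums (Suc (Suc k)) (m + d) \<subseteq> B d"
      "\<And>d. emeasure lborel (B d) \<le> ennreal (1 / (p * rising_prod (Suc k) (m + d)))"
    by (rule measurable_cover_choice) (rule that)
  have "(+) c ` tail_sums (Suc k) m \<subseteq> (\<Union>d. B d)"
  proof
    fix y assume "y \<in> (+) c ` tail_sums (Suc k) m"
    then obtain d t where "t \<in> tail_sums (Suc (Suc k)) (m + d)" "y = c + (s d + t)"
      using tail_sums_decompose[OF Suc.prems, of m] unfolding s_def by blast
    then show "y \<in> (\<Union>d. B d)" using B(2)[of d] by (auto simp: add.assoc)
  qed
  moreover have "emeasure lborel (\<Union>d. B d)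
      \<le> ennreal (1 / (pochhammer (real k) (Suc (Suc i)) * rising_prod k m))"
  proof -
    \<comment> \<open>The bounds for the pieces again form the telescoping series; summing them over
      all cuts gains the factor \<open>1 / k\<close>.\<close>
    have sums: "(\<lambda>d. 1 / (p * rising_prod (Suc k) (m + d)))
        sums (1 / (p * (real k * rising_prod k m)))"
      using sums_divide[OF inverse_rising_prod_sums[OF Suc.prems, of m], of p]
      by (simp add: mult.commute)
    have "emeasure lborel (\<Union>d. B d) \<le> (\<Sum>d. emeasure lborel (B d))"
      by (rule emeasure_subadditive_countably) (use B(1) in auto)
    also have "\<dots> \<le> (\<Sum>d. ennreal (1 / (p * rising_prod (Suc k) (m + d))))"
      by (intro suminf_le B(3)) auto
    also have "\<dots> = ennreal (1 / (p * (real k * rising_prod k m)))"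
      by (rule suminf_ennreal_eq[OF _ sums]) (simp add: p rising_prod_pos less_imp_le)
    \<comment> \<open>The new factor \<open>k\<close> extends \<open>k+1, k+2, ...\<close> at the
      front, whence \<open>pochhammer_rec\<close>.\<close>
    also have "p * (real k * rising_prod k m) = pochhammer (real k) (Suc (Suc i)) * rising_prod k m"
      using pochhammer_rec[of "real k" "Suc i"] by (simp add: p_def add.commute mult_ac)
    finally show ?thesis .
  qed
  ultimately show ?case using B(1) by (intro bexI[of _ "\<Union>d. B d"]) auto
qed

lemma tail_sums_null: "(+) c ` tail_sums 2 m \<in> null_sets lebesgue"
proof -
  \<comment> \<open>The covering bound at \<open>k = 1\<close>, where the Pochhammer symbol is a
    factorial.\<close>
  define b where "b i = 1 / (fact (Suc i) * rising_prod 1 m)" for i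
  have "\<forall>i. \<exists>B\<in>sets lborel. (+) c ` tail_sums 2 m \<subseteq> B \<and>
      emeasure lborel B \<le> ennreal (b i)"
    using tail_sums_cover[of 1 c m]
    by (simp add: b_def pochhammer_fact numeral_2_eq_2 del: fact_Suc)
  then obtain B where B: "\<And>i. B i \<in> sets lborel" "\<And>i. (+) c ` tail_sums 2 m \<subseteq> B i"
      "\<And>i. emeasure lborel (B i) \<le> ennreal (b i)"
    by (rule measurable_cover_choice) (rule that)
  have meas: "(\<Inter>i. B i) \<in> sets lborel"
    using B(1) by (intro sets.countable_INT') auto
  \<comment> \<open>Reciprocal factorials are the terms of the exponential series at 1, hence tend
    to 0.\<close>
  have "(\<lambda>i. inverse (fact (Suc i)) / rising_prod 1 m) \<longlonglongrightarrow> 0 / rising_prod 1 m"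
    using rising_prod_pos[of 1 m] summable_exp[of "1::real"]
    by (intro tendsto_divide tendsto_const LIMSEQ_Suc[where f = "\<lambda>i. inverse (fact i)"]
        summable_LIMSEQ_zero) auto
  then have "b \<longlonglongrightarrow> 0"
    by (simp add: b_def[abs_def] inverse_eq_divide del: fact_Suc)
  then have "(\<lambda>i. ennreal (b i)) \<longlonglongrightarrow> 0" using tendsto_ennrealI by fastforce
  moreover have "emeasure lborel (\<Inter>i. B i) \<le> ennreal (b i)" for i
    by (rule order.trans[OF emeasure_mono B(3)[of i]]) (use B(1) in auto)
  ultimately have "emeasure lborel (\<Inter>i. B i) \<le> 0"
    by (intro LIMSEQ_le_const) auto
  then have "(\<Inter>i. B i) \<in> null_sets lebesgue"
    using meas by (intro null_sets_completionI) (simp add: null_sets_def)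
  moreover have "(+) c ` tail_sums 2 m \<subseteq> (\<Inter>i. B i)" using B(2) by (rule INT_greatest)
  ultimately show ?thesis by (rule null_sets_completion_subset[rotated])
qed

text \<open>Makes every finite head rational, so that the translations range over a countable
  set.\<close>

lemma rising_term_rational: "rising_term f n \<in> \<rat>"
  unfolding rising_term_def by (intro Rats_divide Rats_prod) auto

lemma rising_sum_set_subset:
  "rising_sum_set \<subseteq> (\<Union>q\<in>\<rat>. \<Union>m. (+) q ` tail_sums 2 m)"
proof
  fix x assume "x \<in> rising_sum_set"
  then obtain f where f: "f \<in> nondecreasing_unbounded_seqs" and x: "x = rising_sum f"
    by (auto simp: rising_sum_set_def)
  have lim: "filterlim f at_top sequentially" and mono: "mono_on {1..} f"
    using f by (auto simp: nondecreasing_unbounded_seqs_def)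
  have "eventually (\<lambda>n. 2 \<le> f n) sequentially"
    using lim by (simp add: filterlim_at_top)
  then obtain N where "\<forall>n\<ge>N. 2 \<le> f n" by (auto simp: eventually_sequentially)
  \<comment> \<open>Starting at \<open>Suc N\<close> stays inside \<open>{1..}\<close>, where
    \<open>f\<close> is monotone, and leaves exactly the arguments 1 to \<open>N\<close> for the
    head.\<close>
  then have "f \<in> tail_seqs 2 (Suc N)"
    using lim mono by (auto simp: tail_seqs_def intro: mono_on_subset)
  moreover have "x = (\<Sum>i<N. rising_term f (Suc i)) + (\<Sum>n. rising_term f (Suc N + n))"
    using suminf_split_initial_segment[OF summable_rising_term[OF f], of N]
    by (simp add: x rising_sum_def add_ac)
  moreover have "(\<Sum>i<N. rising_term f (Suc i)) \<in> \<rat>"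
    by (intro Rats_sum rising_term_rational)
  ultimately show "x \<in> (\<Union>q\<in>\<rat>. \<Union>m. (+) q ` tail_sums 2 m)"
    unfolding tail_sums_def by blast
qed

theorem theorem2:
  shows "rising_sum_set \<in> null_sets lebesgue \<and> interior rising_sum_set = {}"
proof
  have "(\<Union>q\<in>\<rat>. \<Union>m. (+) q ` tail_sums 2 m) \<in> null_sets lebesgue"
    by (intro null_sets_UN' null_sets_UN countable_rat tail_sums_null)
  then show null: "rising_sum_set \<in> null_sets lebesgue"
    using rising_sum_set_subset by (rule null_sets_completion_subset[rotated])
  \<comment> \<open>A nonempty open set has positive measure, so the interior must be empty.\<close>
  then have "negligible (interior rising_sum_set)"
    using interior_subset negligible_iff_null_sets negligible_subset by blast
  then show "interior rising_sum_set = {}"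
    using open_not_negligible open_interior by blast
qed

end
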